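(* Let $X$ be a $T_2$ (Hausdorff) topological space. Then the restricted Menger game $G^*_{\mathrm{fin}}(\mathcal{O},\mathcal{O})$ on $X$ is equivalent to the Rothberger game $G_1(\mathcal{O},\mathcal{O})$ on $X$.
   Context: Let $X$ be a topological space and let $\mathcal{O}$ denote the collection of all open covers of $X$. All games are two-player games of length $\omega$ with perfect information, with rounds $n=0,1,2,\dots$. The Rothberger game $G_1(\mathcal{O},\mathcal{O})$ on $X$: in round $n$, player I plays an open cover $\mathcal{U}_n\in\mathcal{O}$, and player II responds with a single set $U_n\in\mathcal{U}_n$. Player II wins the run iff $X=\bigcup_n U_n$; otherwise player I wins. The restricted Menger game $G^*_{\mathrm{fin}}(\mathcal{O},\mathcal{O})$ on $X$: at the start of round $n$, player II first plays a positive integer $k_n$; then player I plays an open cover $\mathcal{U}_n\in\mathcal{O}$; then player II responds by choosing $k_n$ sets $U_n^0,\dots,U_n^{k_n-1}$ from $\mathcal{U}_n$ (repetitions allowed). Player II wins the run iff $X=\bigcup_n\bigcup_{i<k_n}U_n^i$; otherwise player I wins. Two games are equivalent if whenever one of the players has a winning strategy in one of the games, then that same player has a winning strategy in the other game. *)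

theory Defs
  imports "HOL-Analysis.Analysis"
begin

definition open_covers :: "'a topology \<Rightarrow> 'a set set set" where
  "open_covers X = {\<U>. (\<forall>U\<in>\<U>. openin X U) \<and> \<Union>\<U> = topspace X}"

text \<open>
  A strategy is a function of the opponent's previous moves, the player's own previous moves
  being determined by these and the strategy.  Strategies of player I are total: they answer with
  an open cover also after sequences of moves that cannot occur in a run following the strategy.

  A player without a legal move loses.  The only such situation is player II facing the empty
  cover of the empty space.
\<close>

subsection \<open>The Rothberger game\<close>

definition rothberger_II_wins_run :: "'a topology \<Rightarrow> (nat \<Rightarrow> 'a set) \<Rightarrow> bool" where
  "rothberger_II_wins_run X U \<longleftrightarrow> topspace X = (\<Union>n. U n)"

text \<open>\<open>\<sigma> [U\<^sub>0, \<dots>, U\<^sub>n\<^sub>-\<^sub>1]\<close> is the cover played by I in round \<open>n\<close>.\<close>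

definition rothberger_winning_strategy_I ::
    "'a topology \<Rightarrow> ('a set list \<Rightarrow> 'a set set) \<Rightarrow> bool" where
  "rothberger_winning_strategy_I X \<sigma> \<longleftrightarrow>
     (\<forall>h. \<sigma> h \<in> open_covers X) \<and>
     (\<forall>U. (\<forall>n. U n \<in> \<sigma> (map U [0..<n])) \<longrightarrow> \<not> rothberger_II_wins_run X U)"

text \<open>\<open>\<tau> [\<U>\<^sub>0, \<dots>, \<U>\<^sub>n]\<close> is the set played by II in round \<open>n\<close>.\<close>

definition rothberger_winning_strategy_II ::
    "'a topology \<Rightarrow> ('a set set list \<Rightarrow> 'a set) \<Rightarrow> bool" where
  "rothberger_winning_strategy_II X \<tau> \<longleftrightarrow>
     (\<forall>\<U>s. \<U>s \<noteq> [] \<and> set \<U>s \<subseteq> open_covers X \<longrightarrow> \<tau> \<U>s \<in> last \<U>s) \<and>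
     (\<forall>\<U>. (\<forall>n. \<U> n \<in> open_covers X) \<longrightarrow>
        rothberger_II_wins_run X (\<lambda>n. \<tau> (map \<U> [0..<Suc n])))"

definition rothberger_I_has_winning_strategy :: "'a topology \<Rightarrow> bool" where
  "rothberger_I_has_winning_strategy X \<longleftrightarrow> (\<exists>\<sigma>. rothberger_winning_strategy_I X \<sigma>)"

definition rothberger_II_has_winning_strategy :: "'a topology \<Rightarrow> bool" where
  "rothberger_II_has_winning_strategy X \<longleftrightarrow> (\<exists>\<tau>. rothberger_winning_strategy_II X \<tau>)"

subsection \<open>The restricted Menger game\<close>

text \<open>
  The choice of \<open>k\<^sub>n\<close> sets in round \<open>n\<close> is a list \<open>S n\<close> of length \<open>k\<^sub>n\<close>.
\<close>

definition menger_restricted_selections :: "'a set set \<Rightarrow> nat \<Rightarrow> 'a set list set" where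
  "menger_restricted_selections \<U> k = {s. length s = k \<and> set s \<subseteq> \<U>}"

definition menger_restricted_II_wins_run :: "'a topology \<Rightarrow> (nat \<Rightarrow> 'a set list) \<Rightarrow> bool" where
  "menger_restricted_II_wins_run X S \<longleftrightarrow>
     topspace X = (\<Union>n. \<Union>i\<in>{..<length (S n)}. S n ! i)"

text \<open>
  \<open>\<sigma> [S\<^sub>0, \<dots>, S\<^sub>n\<^sub>-\<^sub>1] k\<^sub>n\<close> is the cover played by I in round \<open>n\<close>; the earlier numbers \<open>k\<^sub>i\<close>
  are the lengths of the lists \<open>S\<^sub>i\<close>.
\<close>

definition menger_restricted_winning_strategy_I ::
    "'a topology \<Rightarrow> ('a set list list \<Rightarrow> nat \<Rightarrow> 'a set set) \<Rightarrow> bool" where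
  "menger_restricted_winning_strategy_I X \<sigma> \<longleftrightarrow>
     (\<forall>h k. k > 0 \<longrightarrow> \<sigma> h k \<in> open_covers X) \<and>
     (\<forall>k S. (\<forall>n. k n > 0 \<and>
                  S n \<in> menger_restricted_selections (\<sigma> (map S [0..<n]) (k n)) (k n))
        \<longrightarrow> \<not> menger_restricted_II_wins_run X S)"

text \<open>
  A strategy of II has two parts: \<open>\<kappa> [\<U>\<^sub>0, \<dots>, \<U>\<^sub>n\<^sub>-\<^sub>1]\<close> is the number announced at the start of
  round \<open>n\<close>, before \<open>\<U>\<^sub>n\<close> is known, and \<open>\<tau> [\<U>\<^sub>0, \<dots>, \<U>\<^sub>n]\<close> is the choice made at its end.
\<close>

definition menger_restricted_winning_strategy_II ::
    "'a topology \<Rightarrow> ('a set set list \<Rightarrow> nat) \<Rightarrow> ('a set set list \<Rightarrow> 'a set list) \<Rightarrow> bool" where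
  "menger_restricted_winning_strategy_II X \<kappa> \<tau> \<longleftrightarrow>
     (\<forall>\<U>s. set \<U>s \<subseteq> open_covers X \<longrightarrow> \<kappa> \<U>s > 0) \<and>
     (\<forall>\<U>s. \<U>s \<noteq> [] \<and> set \<U>s \<subseteq> open_covers X \<longrightarrow>
        \<tau> \<U>s \<in> menger_restricted_selections (last \<U>s) (\<kappa> (butlast \<U>s))) \<and>
     (\<forall>\<U>. (\<forall>n. \<U> n \<in> open_covers X) \<longrightarrow>
        menger_restricted_II_wins_run X (\<lambda>n. \<tau> (map \<U> [0..<Suc n])))"

definition menger_restricted_I_has_winning_strategy :: "'a topology \<Rightarrow> bool" where
  "menger_restricted_I_has_winning_strategy X \<longleftrightarrow>
     (\<exists>\<sigma>. menger_restricted_winning_strategy_I X \<sigma>)"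

definition menger_restricted_II_has_winning_strategy :: "'a topology \<Rightarrow> bool" where
  "menger_restricted_II_has_winning_strategy X \<longleftrightarrow>
     (\<exists>\<kappa> \<tau>. menger_restricted_winning_strategy_II X \<kappa> \<tau>)"

end

theory Submission
  imports Defs
begin

text \<open>For player I everything passes through the selection principle
  \<open>rothberger_space\<close>, which knows no history, whereas the covers of a strategy depend
  on earlier moves. Bounding the moves by a sequence \<open>k\<close> leaves finitely many positions
  per round, so demands on all of them at once still define open sets. For player II one run of the
  Rothberger game has to follow countably many positions of the restricted Menger game. Points lying
  in the answer to every cover need moves of their own; the others are handled by branching, which
  must be countable. Complements of answers need not be open, so the Lindelof property is applied to
  complements of closures. Closures enlarge the exceptional set; the Hausdorff axiom keeps it
  finite.\<close>

lemma in_open_covers_iff: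
  "\<U> \<in> open_covers X \<longleftrightarrow> (\<forall>U\<in>\<U>. openin X U) \<and> (\<forall>x\<in>topspace X. \<exists>U\<in>\<U>. x \<in> U)"
proof -
  have "\<Union>\<U> \<subseteq> topspace X" if "\<forall>U\<in>\<U>. openin X U"
    using that openin_subset by (intro Union_least) blast
  then show ?thesis
    unfolding open_covers_def by auto
qed

lemma openin_Collect_ball_finite:
  assumes "finite I" and "\<And>i. i \<in> I \<Longrightarrow> openin X (S i)"
  shows "openin X {x \<in> topspace X. \<forall>i\<in>I. x \<in> S i}"
proof -
  have "{x \<in> topspace X. \<forall>i\<in>I. x \<in> S i} = (\<Inter>i\<in>I. S i) \<inter> topspace X"
    by auto
  then show ?thesis
    using openin_INT[OF assms] by simp
qed

subsection \<open>Player I\<close>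

text \<open>The selection principle S1(O,O). It links the games for player I: it excludes a winning
  strategy in the Rothberger game, and its failure yields one in the restricted Menger game.\<close>

definition rothberger_space :: "'a topology \<Rightarrow> bool" where
  "rothberger_space X \<longleftrightarrow>
     (\<forall>\<U>. (\<forall>n::nat. \<U> n \<in> open_covers X) \<longrightarrow>
        (\<exists>U. (\<forall>n. U n \<in> \<U> n) \<and> topspace X = (\<Union>n. U n)))"

lemma rothberger_spaceD:
  assumes "rothberger_space X" and "\<And>n::nat. \<U> n \<in> open_covers X"
  shows "\<exists>U. (\<forall>n. U n \<in> \<U> n) \<and> topspace X = (\<Union>n. U n)"
  using assms unfolding rothberger_space_def by simp

text \<open>Selecting indices instead of sets keeps data attached to a set, such as the answer
  functions in \<open>rothberger_space_tree\<close>.\<close>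

lemma rothberger_space_indexed:
  assumes S1: "rothberger_space X"
    and op: "\<And>n i. i \<in> I n \<Longrightarrow> openin X (U n i)"
    and cov: "\<And>(n::nat) x. x \<in> topspace X \<Longrightarrow> \<exists>i\<in>I n. x \<in> U n i"
  obtains f where "\<And>n. f n \<in> I n" "\<And>x. x \<in> topspace X \<Longrightarrow> \<exists>n. x \<in> U n (f n)"
proof -
  have "U n ` I n \<in> open_covers X" for n
    using op cov by (auto simp: in_open_covers_iff)
  then obtain W where W: "\<And>n. W n \<in> U n ` I n" "topspace X = (\<Union>n. W n)"
    using rothberger_spaceD[OF S1, of "\<lambda>n. U n ` I n"] by auto
  then have "\<forall>n. \<exists>i\<in>I n. W n = U n i" by blast
  then obtain f where "\<And>n. f n \<in> I n \<and> W n = U n (f n)" by metis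
  then show ?thesis using that[of f] W(2) by auto
qed

text \<open>
  Hurewicz's argument. The sets \<open>V i n b\<close> are open covers increasing in \<open>b\<close> because, by the
  monotonicity of \<open>P\<close>, only the finitely many sequences that first reach \<open>b\<close> at their end matter;
  since \<open>V i n b\<close> controls all sequences of length \<open>n\<close> at once, the selection principle applies.
  The parameter \<open>i\<close> forces every point to be covered infinitely often.
\<close>

lemma rothberger_space_infinitely_often:
  fixes Q :: "nat list \<Rightarrow> nat \<Rightarrow> 'a set"
  assumes S1: "rothberger_space X"
    and op: "\<And>s m. openin X (Q s m)"
    and mono: "\<And>s m m'. m \<le> m' \<Longrightarrow> Q s m \<subseteq> Q s m'"
    and cov: "\<And>s x. x \<in> topspace X \<Longrightarrow> \<exists>m. x \<in> Q s m"
  obtains k where "\<And>x. x \<in> topspace X \<Longrightarrow> infinite {n. x \<in> Q (map k [0..<n]) (k n)}"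
proof -
  define P where "P i t = (\<Union>n\<in>{n. n < length t \<and> i \<le> t ! n}. Q (take n t) (t ! n))"
    for i :: nat and t
  have P_open: "openin X (P i t)" for i t
    unfolding P_def using op by auto
  have P_append: "P i s \<subseteq> P i (s @ r)" for i s r
  proof
    fix x assume "x \<in> P i s"
    then obtain n where "n < length s" "i \<le> s ! n" "x \<in> Q (take n s) (s ! n)"
      by (auto simp: P_def)
    then show "x \<in> P i (s @ r)"
      unfolding P_def by (auto intro!: exI[of _ n] simp: nth_append)
  qed
  have P_snoc: "P i (s @ [m]) = P i s \<union> (if i \<le> m then Q s m else {})" for i s m
    by (auto simp: P_def nth_append less_Suc_eq split: if_splits)
  have P_mono: "P i (s @ [m]) \<subseteq> P i (s @ [m'])" if "m \<le> m'" for i s m m'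
    using mono[OF that, of s] that by (auto simp: P_snoc)
  have P_cov: "\<exists>m. x \<in> P i (s @ [m])" if "x \<in> topspace X" for x i s
  proof -
    obtain m where "x \<in> Q s m" using cov[OF \<open>x \<in> topspace X\<close>] by blast
    then have "x \<in> P i (s @ [max i m])"
      using mono[of m "max i m" s] by (auto simp: P_snoc)
    then show ?thesis ..
  qed
  define V where "V i n b = {x \<in> topspace X. \<forall>t. length t \<le> n \<and> (\<exists>c\<in>set t. b \<le> c) \<longrightarrow> x \<in> P i t}"
    for i n and b :: nat
  define L where "L n b = {s. set s \<subseteq> {..<b} \<and> length s \<le> n}" for n and b :: nat
  have fin_L: "finite (L n b)" for n b
    unfolding L_def by (rule finite_lists_length_le) simp
  have V_eq: "V i (Suc n) b = {x \<in> topspace X. \<forall>s\<in>L n b. x \<in> P i (s @ [b])}" for i n b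
  proof (intro set_eqI iffI)
    fix x assume "x \<in> V i (Suc n) b"
    then show "x \<in> {x \<in> topspace X. \<forall>s\<in>L n b. x \<in> P i (s @ [b])}"
      by (auto simp: V_def L_def)
  next
    fix x assume x: "x \<in> {x \<in> topspace X. \<forall>s\<in>L n b. x \<in> P i (s @ [b])}"
    have "x \<in> P i t" if len: "length t \<le> Suc n" and ex: "\<exists>c\<in>set t. b \<le> c" for t
    proof -
      obtain s c r where t: "t = s @ c # r" "b \<le> c" "\<forall>d\<in>set s. \<not> b \<le> d"
        using split_list_first_prop[OF ex] by blast
      then have "s \<in> L n b" using len by (auto simp: L_def)
      then have "x \<in> P i (s @ [b])" using x by blast
      then show ?thesis
        using P_mono[OF t(2), of i s] P_append[of i "s @ [c]" r] t(1) by auto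
    qed
    then show "x \<in> V i (Suc n) b" using x by (auto simp: V_def)
  qed
  have V_open: "openin X (V i (Suc n) b)" for i n b
    unfolding V_eq using fin_L P_open by (rule openin_Collect_ball_finite)
  have V_cov: "\<exists>b. x \<in> V i n b" if x: "x \<in> topspace X" for x i n
  proof (induction n)
    case 0
    then show ?case using x by (auto simp: V_def)
  next
    case (Suc n)
    then obtain b0 where b0: "x \<in> V i n b0" by blast
    obtain M where M: "\<And>s. x \<in> P i (s @ [M s])" using P_cov[OF x] by metis
    \<comment> \<open>\<open>b\<close> dominates \<open>b0\<close> and the answers
      \<open>M s\<close> for the finitely many \<open>s\<close> below \<open>b0\<close>: either
      \<open>t\<close> without its last entry already reaches \<open>b0\<close>, or it is such an
      \<open>s\<close> and the last entry is at least \<open>M s\<close>.\<close>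
    define b where "b = Max (insert b0 (M ` L n b0))"
    have b: "b0 \<le> b" "\<And>s. s \<in> L n b0 \<Longrightarrow> M s \<le> b"
      unfolding b_def using fin_L by (auto intro: Max_ge)
    have "x \<in> P i t" if len: "length t \<le> Suc n" and ex: "\<exists>c\<in>set t. b \<le> c" for t
    proof -
      obtain s c where t: "t = s @ [c]" using ex by (cases t rule: rev_cases) auto
      show ?thesis
      proof (cases "\<exists>d\<in>set s. b0 \<le> d")
        case True
        then have "x \<in> P i s" using b0 len t by (auto simp: V_def)
        then show ?thesis using P_append t by blast
      next
        case False
        then have s: "s \<in> L n b0" using len t by (auto simp: L_def)
        have "b \<le> c" using ex False b(1) t by fastforce
        then show ?thesis using M[of s] b(2)[OF s] P_mono[of "M s" c i s] t by auto
      qed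
    qed
    then have "x \<in> V i (Suc n) b" using x by (auto simp: V_def)
    then show ?case ..
  qed
  \<comment> \<open>\<open>prod_encode\<close> reserves infinitely many rounds for each threshold
    \<open>i\<close>. The \<open>Suc\<close> is there because round \<open>n\<close> has to control
    sequences of length \<open>n + 1\<close>, its own value included.\<close>
  have "\<exists>f. \<forall>x\<in>topspace X. \<exists>m. x \<in> V i (Suc (prod_encode (i, m))) (f m)" for i
  proof -
    obtain f where "\<And>x. x \<in> topspace X \<Longrightarrow> \<exists>m. x \<in> V i (Suc (prod_encode (i, m))) (f m)"
      by (rule rothberger_space_indexed[OF S1, where I = "\<lambda>_. UNIV"
            and U = "\<lambda>m b. V i (Suc (prod_encode (i, m))) b"])
         (use V_open V_cov in auto)
    then show ?thesis by blast
  qed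
  then obtain F where
    F: "\<And>i x. x \<in> topspace X \<Longrightarrow> \<exists>m. x \<in> V i (Suc (prod_encode (i, m))) (F i m)"
    by metis
  define k where "k n = (case prod_decode n of (i, m) \<Rightarrow> F i m)" for n
  show thesis
  proof
    fix x assume x: "x \<in> topspace X"
    \<comment> \<open>Finitely many hits would bound \<open>k\<close> on them, so hits with
      arbitrarily large \<open>k n\<close> are infinitely many.\<close>
    have hit: "\<exists>n. x \<in> Q (map k [0..<n]) (k n) \<and> i \<le> k n" for i
    proof -
      obtain m where m: "x \<in> V i (Suc (prod_encode (i, m))) (F i m)" using F[OF x] by blast
      define n where "n = prod_encode (i, m)"
      have "x \<in> V i (Suc n) (k n)" using m by (simp add: n_def k_def)
      moreover have "k n \<in> set (map k [0..<Suc n])" by simp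
      ultimately have "x \<in> P i (map k [0..<Suc n])"
        unfolding V_def by (force simp del: upt_Suc)
      then show ?thesis
        by (auto simp: P_def take_map simp del: upt_Suc)
    qed
    show "infinite {n. x \<in> Q (map k [0..<n]) (k n)}"
    proof
      assume fin: "finite {n. x \<in> Q (map k [0..<n]) (k n)}"
      obtain n where "x \<in> Q (map k [0..<n]) (k n)"
        "Suc (Max (k ` {n. x \<in> Q (map k [0..<n]) (k n)})) \<le> k n"
        using hit by blast
      moreover from this have "k n \<le> Max (k ` {n. x \<in> Q (map k [0..<n]) (k n)})"
        using fin by (intro Max_ge) auto
      ultimately show False by simp
    qed
  qed
qed

text \<open>Greedy choice: \<open>A m\<close> has more elements than there are earlier
  representatives.\<close>

lemma distinct_representatives:
  assumes "\<And>m::nat. finite (A m) \<and> card (A m) = Suc m"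
  obtains r where "inj r" "\<And>m. r m \<in> A m"
proof -
  have "\<exists>r. \<forall>m. r m \<in> A m - r ` {..<m}"
  proof (rule dependent_wellorder_choice)
    fix r :: 'a and f g :: "nat \<Rightarrow> 'a" and m :: nat
    assume "\<And>y. y < m \<Longrightarrow> f y = g y"
    then have "f ` {..<m} = g ` {..<m}" by (intro image_cong) auto
    then show "(r \<in> A m - f ` {..<m}) = (r \<in> A m - g ` {..<m})" by simp
  next
    fix m :: nat and f :: "nat \<Rightarrow> 'a"
    have "card (f ` {..<m}) < card (A m)"
      using card_image_le[of "{..<m}" f] assms[of m] by simp
    then have "\<not> A m \<subseteq> f ` {..<m}" using card_mono[of "f ` {..<m}" "A m"] by auto
    then show "\<exists>r. r \<in> A m - f ` {..<m}" by blast
  qed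
  then obtain r where r: "\<And>m. r m \<in> A m - r ` {..<m}" by blast
  have "inj r"
  proof (rule linorder_injI)
    fix i j :: nat assume "i < j"
    then have "r i \<in> r ` {..<j}" by simp
    then show "r i \<noteq> r j" using r[of j] by auto
  qed
  then show thesis using that[of r] r by simp
qed

lemma finite_list_all2_le: "finite {s :: nat list. list_all2 (\<le>) s t}"
proof (induction t)
  case (Cons a t)
  have "{s. list_all2 (\<le>) s (a # t)} = (\<lambda>(c, s). c # s) ` ({..a} \<times> {s. list_all2 (\<le>) s t})"
    by (auto simp: list_all2_Cons2 image_iff)
  then show ?case using Cons by simp
qed simp

text \<open>
  Pawlikowski's theorem. Membership of \<open>x\<close> in \<open>Q (map k [0..<n]) (k n)\<close> means that every position
  of length \<open>n\<close> below \<open>k\<close> has an answer below \<open>k n\<close> containing \<open>x\<close>. A selection of \<open>m + 1\<close>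
  rounds in the \<open>m\<close>-th cover leaves one round not yet used by the earlier selections, in which the
  answer function \<open>G\<close> of the selected set is followed.
\<close>

lemma rothberger_space_tree:
  fixes U :: "nat list \<Rightarrow> nat \<Rightarrow> 'a set"
  assumes S1: "rothberger_space X"
    and op: "\<And>s j. openin X (U s j)"
    and cov: "\<And>s x. x \<in> topspace X \<Longrightarrow> \<exists>j. x \<in> U s j"
  obtains f where "\<And>x. x \<in> topspace X \<Longrightarrow> \<exists>n. x \<in> U (map f [0..<n]) (f n)"
proof -
  define B :: "nat list \<Rightarrow> nat list set" where "B t = {s. list_all2 (\<le>) s t}" for t
  have fin_B: "finite (B t)" for t
    unfolding B_def by (rule finite_list_all2_le)
  define Q where "Q t m = {x \<in> topspace X. \<forall>s\<in>B t. x \<in> (\<Union>j\<le>m. U s j)}" for t m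
  obtain k where k: "\<And>x. x \<in> topspace X \<Longrightarrow> infinite {n. x \<in> Q (map k [0..<n]) (k n)}"
  proof (rule rothberger_space_infinitely_often[OF S1, of Q])
    show "openin X (Q t m)" for t m
      unfolding Q_def using fin_B by (rule openin_Collect_ball_finite) (use op in blast)
    show "Q t m \<subseteq> Q t m'" if "m \<le> m'" for t m m'
      unfolding Q_def using that by fastforce
    show "\<exists>m. x \<in> Q t m" if x: "x \<in> topspace X" for t x
    proof -
      obtain J where J: "\<And>s. x \<in> U s (J s)" using cov[OF x] by metis
      have "\<forall>s\<in>B t. J s \<le> Max (J ` B t)" using fin_B by auto
      then have "x \<in> Q t (Max (J ` B t))" unfolding Q_def using J x by blast
      then show ?thesis ..
    qed
  qed blast
  \<comment> \<open>\<open>G\<close> answers every position below \<open>k\<close>, since the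
    position that arises in round \<open>n\<close> is not yet known when the selection is
    made.\<close>
  define I where "I m = {(A, G). finite A \<and> card A = Suc m \<and>
      (\<forall>n\<in>A. \<forall>s\<in>B (map k [0..<n]). G n s \<le> k n)}" for m
  define W where "W = (\<lambda>(A, G). {x \<in> topspace X. \<forall>n\<in>A. \<forall>s\<in>B (map k [0..<n]). x \<in> U s (G n s)})"
  obtain sel where sel: "\<And>m. sel m \<in> I m" "\<And>x. x \<in> topspace X \<Longrightarrow> \<exists>m. x \<in> W (sel m)"
  proof (rule rothberger_space_indexed[OF S1, where I = I and U = "\<lambda>_. W"])
    fix m i assume "i \<in> I m"
    then obtain A G where i: "i = (A, G)" "finite A" by (auto simp: I_def)
    have "W i = {x \<in> topspace X. \<forall>p\<in>SIGMA n:A. B (map k [0..<n]).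
        x \<in> U (snd p) (G (fst p) (snd p))}"
      by (auto simp: W_def i(1))
    then show "openin X (W i)"
      using i(2) fin_B op by (simp only:) (intro openin_Collect_ball_finite finite_SigmaI)
  next
    fix m x assume x: "x \<in> topspace X"
    obtain A where A: "A \<subseteq> {n. x \<in> Q (map k [0..<n]) (k n)}" "finite A" "card A = Suc m"
      using infinite_arbitrarily_large[OF k[OF x]] by metis
    have "\<forall>n s. \<exists>j. n \<in> A \<and> s \<in> B (map k [0..<n]) \<longrightarrow> j \<le> k n \<and> x \<in> U s j"
      using A(1) unfolding Q_def by blast
    then obtain G where "\<And>n s. n \<in> A \<and> s \<in> B (map k [0..<n]) \<longrightarrow> G n s \<le> k n \<and> x \<in> U s (G n s)"
      by metis
    then show "\<exists>i\<in>I m. x \<in> W i"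
      using A x by (intro bexI[of _ "(A, G)"]) (auto simp: I_def W_def)
  qed blast
  define A G where "A m = fst (sel m)" and "G m = snd (sel m)" for m
  have A: "finite (A m) \<and> card (A m) = Suc m"
    and G: "\<And>n s. n \<in> A m \<Longrightarrow> s \<in> B (map k [0..<n]) \<Longrightarrow> G m n s \<le> k n" for m
    using sel(1)[of m] by (auto simp: A_def G_def I_def)
  obtain r where r: "inj r" "\<And>m. r m \<in> A m"
    using distinct_representatives[of A] A by blast
  have "\<exists>f. \<forall>n. f n = (if n \<in> range r then G (inv r n) n (map f [0..<n]) else 0)"
  proof (rule dependent_wellorder_choice)
    fix i :: nat and f g :: "nat \<Rightarrow> nat" and n :: nat
    assume "\<And>y. y < n \<Longrightarrow> f y = g y"
    then have "map f [0..<n] = map g [0..<n]" by simp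
    then show "(i = (if n \<in> range r then G (inv r n) n (map f [0..<n]) else 0)) =
        (i = (if n \<in> range r then G (inv r n) n (map g [0..<n]) else 0))"
      by (simp only:)
  qed blast
  then obtain f where
    f: "\<And>n. f n = (if n \<in> range r then G (inv r n) n (map f [0..<n]) else 0)" by blast
  have f_r: "f (r m) = G m (r m) (map f [0..<r m])" for m
    using f[of "r m"] r(1) by simp
  have in_B: "map f [0..<n] \<in> B (map k [0..<n])" if "\<And>i. i < n \<Longrightarrow> f i \<le> k i" for n
    using that by (auto simp: B_def list_all2_conv_all_nth)
  have f_le: "f n \<le> k n" for n
  proof (induction n rule: less_induct)
    case (less n)
    show ?case
    proof (cases "n \<in> range r")
      case True
      then obtain m where "n = r m" by blast
      then show ?thesis using G[OF r(2)] in_B less f_r by metis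
    qed (use f[of n] in simp)
  qed
  show thesis
  proof
    fix x assume "x \<in> topspace X"
    then obtain m where "x \<in> W (sel m)" using sel(2) by blast
    then have "x \<in> U (map f [0..<r m]) (G m (r m) (map f [0..<r m]))"
      using r(2)[of m] in_B f_le by (auto simp: W_def A_def G_def split: prod.splits)
    then show "\<exists>n. x \<in> U (map f [0..<n]) (f n)" using f_r by metis
  qed
qed

text \<open>For a constant sequence of covers, S1(O,O) lists a countable subcover. This turns the
  strategy of I into a tree over \<open>nat list\<close>, and a branch that covers \<open>X\<close>
  defeats it.\<close>

lemma rothberger_space_imp_no_winning_strategy_I:
  assumes S1: "rothberger_space X"
  shows "\<not> rothberger_I_has_winning_strategy X"
proof
  assume "rothberger_I_has_winning_strategy X"
  then obtain \<sigma> where \<sigma>: "\<And>h. \<sigma> h \<in> open_covers X"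
    and wins: "\<And>U. (\<And>n. U n \<in> \<sigma> (map U [0..<n])) \<Longrightarrow> \<not> rothberger_II_wins_run X U"
    unfolding rothberger_I_has_winning_strategy_def rothberger_winning_strategy_I_def by blast
  have "\<forall>h. \<exists>e :: nat \<Rightarrow> 'a set. (\<forall>n. e n \<in> \<sigma> h) \<and> topspace X = (\<Union>n. e n)"
    using rothberger_spaceD[OF S1, of "\<lambda>_. \<sigma> h" for h] \<sigma> by simp
  then obtain e where e: "\<And>h n. e h n \<in> \<sigma> h" "\<And>h. topspace X = (\<Union>n::nat. e h n)" by metis
  \<comment> \<open>Decodes indices into moves from left to right, each entry relative to the cover
    that answers the moves decoded so far.\<close>
  define hist where "hist = foldl (\<lambda>h j. h @ [e h j]) []"
  obtain f where f: "\<And>x. x \<in> topspace X \<Longrightarrow> \<exists>n. x \<in> e (hist (map f [0..<n])) (f n)"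
  proof (rule rothberger_space_tree[OF S1, of "\<lambda>s. e (hist s)"])
    show "openin X (e (hist s) j)" for s j
      using e(1) \<sigma> by (auto simp: in_open_covers_iff)
    show "\<exists>j. x \<in> e (hist s) j" if "x \<in> topspace X" for s x
      using e(2) that by blast
  qed blast
  define U where "U n = e (hist (map f [0..<n])) (f n)" for n
  have "map U [0..<n] = hist (map f [0..<n])" for n
    by (induction n) (auto simp: hist_def U_def)
  then have "\<not> rothberger_II_wins_run X U"
    using e(1) by (intro wins) (simp add: U_def)
  moreover have "topspace X = (\<Union>n. U n)"
    using f e(2) unfolding U_def by blast
  ultimately show False by (simp add: rothberger_II_wins_run_def)
qed

text \<open>
  If \<open>\<U>\<close> admits no covering selection, player I wins by playing a common refinement of the next
  \<open>k\<^sub>n\<close> covers of \<open>\<U>\<close> that have not been used yet.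
\<close>

lemma not_rothberger_space_imp_menger_restricted_I:
  assumes "\<not> rothberger_space X"
  shows "menger_restricted_I_has_winning_strategy X"
proof -
  obtain \<U> where \<U>: "\<And>n::nat. \<U> n \<in> open_covers X"
    and no_sel: "\<And>U. (\<And>n. U n \<in> \<U> n) \<Longrightarrow> topspace X \<noteq> (\<Union>n. U n)"
    using assms unfolding rothberger_space_def by blast
  define \<sigma> where "\<sigma> h k = {\<Inter>i<k. u i | u. \<forall>i<k. u i \<in> \<U> (length (concat h) + i)}"
    for h :: "'a set list list" and k :: nat
  have cover: "\<sigma> h k \<in> open_covers X" if "k > 0" for h k
    unfolding in_open_covers_iff
  proof (intro conjI ballI)
    fix V assume "V \<in> \<sigma> h k"
    then obtain u where u: "V = (\<Inter>i<k. u i)" "\<forall>i<k. u i \<in> \<U> (length (concat h) + i)"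
      by (auto simp: \<sigma>_def)
    then have "openin X (u i)" if "i < k" for i
      using \<U> that by (auto simp: in_open_covers_iff)
    then show "openin X V" using u(1) \<open>k > 0\<close> by (auto intro!: openin_INT2)
  next
    fix x assume x: "x \<in> topspace X"
    have "\<forall>i. \<exists>v\<in>\<U> (length (concat h) + i). x \<in> v"
      using \<U> x by (auto simp: in_open_covers_iff)
    then obtain u where u: "\<And>i. u i \<in> \<U> (length (concat h) + i) \<and> x \<in> u i" by metis
    then have "(\<Inter>i<k. u i) \<in> \<sigma> h k" unfolding \<sigma>_def by blast
    then show "\<exists>V\<in>\<sigma> h k. x \<in> V" using u by blast
  qed
  have "\<not> menger_restricted_II_wins_run X S"
    if run: "\<And>n. k n > 0 \<and> S n \<in> menger_restricted_selections (\<sigma> (map S [0..<n]) (k n)) (k n)"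
    for k S
  proof
    assume win: "menger_restricted_II_wins_run X S"
    have S: "length (S n) = k n" "set (S n) \<subseteq> \<sigma> (map S [0..<n]) (k n)" "k n > 0" for n
      using run[of n] by (auto simp: menger_restricted_selections_def)
    let ?c = "\<lambda>n. concat (map S [0..<n])"
    have refine: "\<exists>v\<in>\<U> N. ?c n ! N \<subseteq> v" if "N < length (?c n)" for n N
      using that
    proof (induction n)
      case (Suc n)
      show ?case
      proof (cases "N < length (?c n)")
        case True
        then show ?thesis using Suc.IH by (simp add: nth_append)
      next
        case False
        define i where "i = N - length (?c n)"
        have i: "N = length (?c n) + i" "i < k n"
          using False Suc.prems S(1)[of n] by (auto simp: i_def)
        then have "S n ! i \<in> \<sigma> (map S [0..<n]) (k n)"
          using S(1,2) by (metis nth_mem subsetD)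
        then obtain u where "S n ! i = (\<Inter>i<k n. u i)" "\<forall>i<k n. u i \<in> \<U> (length (?c n) + i)"
          by (auto simp: \<sigma>_def)
        then show ?thesis using i by (auto simp: nth_append)
      qed
    qed simp
    \<comment> \<open>As every \<open>k n\<close> is positive, entry \<open>N\<close> of the
      flattened choices exists by stage \<open>Suc N\<close>.\<close>
    have len: "n \<le> length (?c n)" for n
    proof (induction n)
      case (Suc n)
      then show ?case using S(1,3)[of n] by simp
    qed simp
    have stable: "?c (n + d) ! N = ?c n ! N" if "N < length (?c n)" for n d N
      using that
    proof (induction d)
      case (Suc d)
      have "length (?c n) \<le> length (?c (n + d))" for d
        by (induction d) auto
      then have "N < length (?c (n + d))" using Suc.prems order_less_le_trans by blast
      then show ?case using Suc by (simp add: nth_append)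
    qed simp
    have "\<forall>N. \<exists>v\<in>\<U> N. ?c (Suc N) ! N \<subseteq> v"
      using refine len Suc_le_lessD by blast
    then obtain u where u: "\<And>N. u N \<in> \<U> N" "\<And>N. ?c (Suc N) ! N \<subseteq> u N" by metis
    have "x \<in> (\<Union>N. u N)" if "x \<in> topspace X" for x
    proof -
      obtain n i where ni: "i < length (S n)" "x \<in> S n ! i"
        using win \<open>x \<in> topspace X\<close> by (auto simp: menger_restricted_II_wins_run_def)
      define N where "N = length (?c n) + i"
      have N: "N < length (?c (Suc n))" "?c (Suc n) ! N = S n ! i"
        using ni by (auto simp: N_def)
      \<comment> \<open>Both stages are compared with their sum, which avoids a case distinction on
        \<open>n\<close> and \<open>N\<close>.\<close>
      have "?c (Suc N) ! N = ?c (Suc n) ! N"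
        using stable[of N "Suc n" "Suc N"] stable[of N "Suc N" "Suc n"] N(1) len[of "Suc N"]
        by (simp only: add.commute Suc_le_eq)
      then show ?thesis using u(2)[of N] N(2) ni(2) by auto
    qed
    moreover have "u N \<subseteq> topspace X" for N
      using u(1)[of N] \<U>[of N] openin_subset by (auto simp: in_open_covers_iff)
    ultimately show False using no_sel[of u] u(1) by blast
  qed
  then have "menger_restricted_winning_strategy_I X \<sigma>"
    using cover unfolding menger_restricted_winning_strategy_I_def by blast
  then show ?thesis unfolding menger_restricted_I_has_winning_strategy_def by blast
qed

lemma menger_restricted_I_imp_rothberger_I:
  assumes "menger_restricted_I_has_winning_strategy X"
  shows "rothberger_I_has_winning_strategy X"
proof -
  obtain \<sigma> where \<sigma>: "menger_restricted_winning_strategy_I X \<sigma>"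
    using assms menger_restricted_I_has_winning_strategy_def by blast
  have "\<not> rothberger_II_wins_run X U"
    if "\<And>n. U n \<in> \<sigma> (map (\<lambda>u. [u]) (map U [0..<n])) 1" for U
  proof -
    have "\<not> menger_restricted_II_wins_run X (\<lambda>n. [U n])"
      using \<sigma> that unfolding menger_restricted_winning_strategy_I_def
      by (auto simp: menger_restricted_selections_def o_def dest!: spec[of _ "\<lambda>_. 1"])
    then show ?thesis
      by (simp add: menger_restricted_II_wins_run_def rothberger_II_wins_run_def lessThan_Suc)
  qed
  then have "rothberger_winning_strategy_I X (\<lambda>h. \<sigma> (map (\<lambda>u. [u]) h) 1)"
    using \<sigma> unfolding rothberger_winning_strategy_I_def menger_restricted_winning_strategy_I_def
    by auto
  then show ?thesis unfolding rothberger_I_has_winning_strategy_def by blast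
qed

subsection \<open>Player II\<close>

lemma rothberger_II_imp_menger_restricted_II:
  assumes "rothberger_II_has_winning_strategy X"
  shows "menger_restricted_II_has_winning_strategy X"
proof -
  obtain \<tau> where "rothberger_winning_strategy_II X \<tau>"
    using assms rothberger_II_has_winning_strategy_def by blast
  then have "menger_restricted_winning_strategy_II X (\<lambda>_. 1) (\<lambda>\<U>s. [\<tau> \<U>s])"
    by (simp add: rothberger_winning_strategy_II_def menger_restricted_winning_strategy_II_def
        menger_restricted_selections_def menger_restricted_II_wins_run_def
        rothberger_II_wins_run_def lessThan_Suc)
  then show ?thesis unfolding menger_restricted_II_has_winning_strategy_def by blast
qed

text \<open>
  A state tree in which the node \<open>j # s\<close> is the \<open>j\<close>-th successor of \<open>s\<close>, depending on the set that
  was played at \<open>s\<close>. As the code of \<open>s\<close> is smaller than that of \<open>j # s\<close>, player II can visit all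
  nodes in the order of their codes.
\<close>

primrec tree_state ::
    "('s \<Rightarrow> 'a) \<Rightarrow> 's \<Rightarrow> ('s \<Rightarrow> 'a set \<Rightarrow> nat \<Rightarrow> 's) \<Rightarrow> (nat \<Rightarrow> 'a set set) \<Rightarrow> nat list \<Rightarrow> 's" where
  "tree_state pt init nxt \<U> [] = init"
| "tree_state pt init nxt \<U> (j # s) =
     nxt (tree_state pt init nxt \<U> s)
       (SOME U. U \<in> \<U> (list_encode s) \<and> pt (tree_state pt init nxt \<U> s) \<in> U) j"

lemma list_encode_less_Cons: "list_encode s < list_encode (j # s)"
  using le_prod_encode_2[of "list_encode s" j] by simp

lemma tree_state_cong:
  assumes "\<And>i. i < list_encode s \<Longrightarrow> \<U> i = \<U>' i"
  shows "tree_state pt init nxt \<U> s = tree_state pt init nxt \<U>' s"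
  using assms
proof (induction s)
  case (Cons j s)
  have "tree_state pt init nxt \<U> s = tree_state pt init nxt \<U>' s"
    using Cons less_trans[OF _ list_encode_less_Cons] by blast
  moreover have "\<U> (list_encode s) = \<U>' (list_encode s)"
    using Cons.prems list_encode_less_Cons by blast
  ultimately show ?case by simp
qed simp

text \<open>Enumerating the nodes by their codes serves all branches within one run of length omega.
  \<open>R\<close> is the set of states occurring in that run; later arguments use only its closure
  under successors, not the coding.\<close>

lemma rothberger_II_tree_strategy:
  fixes X :: "'a topology" and pt :: "'s \<Rightarrow> 'a" and nxt :: "'s \<Rightarrow> 'a set \<Rightarrow> nat \<Rightarrow> 's"
  assumes pt: "\<And>st. pt st \<in> topspace X"
  obtains \<tau> where
    "\<And>\<U>s. \<U>s \<noteq> [] \<Longrightarrow> set \<U>s \<subseteq> open_covers X \<Longrightarrow> \<tau> \<U>s \<in> last \<U>s"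
    "\<And>\<U>. (\<And>n. \<U> n \<in> open_covers X) \<Longrightarrow>
       \<exists>R. init \<in> R \<and> (\<forall>st\<in>R. \<exists>n. pt st \<in> \<tau> (map \<U> [0..<Suc n]) \<and>
              (\<forall>j. nxt st (\<tau> (map \<U> [0..<Suc n])) j \<in> R))"
proof -
  let ?st = "tree_state pt init nxt"
  define W where "W \<U> n = (SOME U. U \<in> \<U> n \<and> pt (?st \<U> (list_decode n)) \<in> U)" for \<U> n
  have W: "W \<U> n \<in> \<U> n \<and> pt (?st \<U> (list_decode n)) \<in> W \<U> n" if "\<U> n \<in> open_covers X" for \<U> n
  proof -
    have "\<exists>U. U \<in> \<U> n \<and> pt (?st \<U> (list_decode n)) \<in> U"
      using that pt by (auto simp: in_open_covers_iff)
    then show ?thesis unfolding W_def by (rule someI_ex)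
  qed
  \<comment> \<open>Entries beyond the end of the list are unspecified but never matter: the state
    at code \<open>n\<close> depends only on covers before \<open>n\<close>, and the choice itself
    on cover \<open>n\<close>.\<close>
  define \<tau> where "\<tau> \<U>s = W (\<lambda>i. \<U>s ! i) (length \<U>s - 1)" for \<U>s
  have \<tau>_run: "\<tau> (map \<U> [0..<Suc n]) = W \<U> n" for \<U> n
  proof -
    have nth: "map \<U> [0..<Suc n] ! i = \<U> i" if "i \<le> n" for i
      using that by (simp del: upt_Suc)
    have "?st (\<lambda>i. map \<U> [0..<Suc n] ! i) (list_decode n) = ?st \<U> (list_decode n)"
      by (rule tree_state_cong) (use nth in simp)
    then show ?thesis
      unfolding \<tau>_def W_def using nth[of n] by simp
  qed
  show thesis
  proof
    fix \<U>s assume "\<U>s \<noteq> []" and "set \<U>s \<subseteq> open_covers X"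
    then show "\<tau> \<U>s \<in> last \<U>s"
      unfolding \<tau>_def using W[of "\<lambda>i. \<U>s ! i" "length \<U>s - 1"]
      by (metis last_conv_nth last_in_set subsetD)
  next
    fix \<U> assume \<U>: "\<And>n::nat. \<U> n \<in> open_covers X"
    show "\<exists>R. init \<in> R \<and> (\<forall>st\<in>R. \<exists>n. pt st \<in> \<tau> (map \<U> [0..<Suc n]) \<and>
              (\<forall>j. nxt st (\<tau> (map \<U> [0..<Suc n])) j \<in> R))"
    proof (intro exI[of _ "range (?st \<U>)"] conjI ballI)
      show "init \<in> range (?st \<U>)"
        by (rule range_eqI[of _ _ "[]"]) simp
      fix st assume "st \<in> range (?st \<U>)"
      then obtain s where s: "st = ?st \<U> s" by blast
      have "nxt st (W \<U> (list_encode s)) j = ?st \<U> (j # s)" for j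
        by (simp add: W_def s)
      then have "\<forall>j. nxt st (W \<U> (list_encode s)) j \<in> range (?st \<U>)" by (metis rangeI)
      moreover have "pt st \<in> W \<U> (list_encode s)"
        using W[of \<U> "list_encode s", OF \<U>] s by simp
      ultimately show "\<exists>n. pt st \<in> \<tau> (map \<U> [0..<Suc n]) \<and>
              (\<forall>j. nxt st (\<tau> (map \<U> [0..<Suc n])) j \<in> range (?st \<U>))"
        unfolding \<tau>_run by blast
    qed
  qed
qed

text \<open>Around \<open>y\<close>, intersect finitely many open sets, each disjoint from a
  neighbourhood of another point of \<open>F\<close>; the closure of the result contains no point of
  \<open>F\<close> except possibly \<open>y\<close>.\<close>

lemma Hausdorff_cover_closures_separating:
  assumes "Hausdorff_space X" and "finite F" and "F \<subseteq> topspace X"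
  shows "{U. openin X U \<and> (\<forall>x\<in>F. \<forall>y\<in>F. x \<in> X closure_of U \<and> y \<in> X closure_of U \<longrightarrow> x = y)}
    \<in> open_covers X" (is "?C \<in> _")
proof -
  have "\<exists>U\<in>?C. y \<in> U" if y: "y \<in> topspace X" for y
  proof -
    have "\<forall>x\<in>F - {y}. \<exists>A B. openin X A \<and> openin X B \<and> x \<in> A \<and> y \<in> B \<and> disjnt A B"
      using assms(1,3) y unfolding Hausdorff_space_def by blast
    then obtain A B where AB: "\<And>x. x \<in> F - {y} \<Longrightarrow>
        openin X (A x) \<and> openin X (B x) \<and> x \<in> A x \<and> y \<in> B x \<and> disjnt (A x) (B x)"
      by metis
    define U where "U = {z \<in> topspace X. \<forall>x\<in>F - {y}. z \<in> B x}"
    have "openin X U"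
      unfolding U_def using AB assms(2) by (intro openin_Collect_ball_finite) auto
    moreover have "x \<notin> X closure_of U" if "x \<in> F - {y}" for x
      using AB[OF that] that unfolding U_def in_closure_of disjnt_def by blast
    moreover have "y \<in> U" using AB y by (auto simp: U_def)
    ultimately show ?thesis by blast
  qed
  then show ?thesis by (auto simp: in_open_covers_iff)
qed

text \<open>
  In the Hausdorff case only finitely many points, at most as many as player II announces, lie in the
  closure of the answer of player II to every cover. If neighbourhoods of these points are already
  covered then, the space being Lindelof, countably many covers suffice to leave every remaining
  point outside the answer to one of them.
\<close>

lemma menger_restricted_II_imp_rothberger_II:
  assumes T2: "Hausdorff_space X" and "menger_restricted_II_has_winning_strategy X"
  shows "rothberger_II_has_winning_strategy X"
proof -
  obtain \<kappa> \<tau> where strat: "menger_restricted_winning_strategy_II X \<kappa> \<tau>"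
    using assms(2) menger_restricted_II_has_winning_strategy_def by blast
  then have \<kappa>: "\<And>h. set h \<subseteq> open_covers X \<Longrightarrow> \<kappa> h > 0"
    and run: "\<And>\<U>. (\<And>n. \<U> n \<in> open_covers X) \<Longrightarrow>
         menger_restricted_II_wins_run X (\<lambda>n. \<tau> (map \<U> [0..<Suc n]))"
    unfolding menger_restricted_winning_strategy_II_def by blast+
  have \<tau>: "length (\<tau> (h @ [\<U>])) = \<kappa> h \<and> set (\<tau> (h @ [\<U>])) \<subseteq> \<U>"
    if "set h \<subseteq> open_covers X" "\<U> \<in> open_covers X" for h \<U>
  proof -
    have "\<tau> (h @ [\<U>]) \<in> menger_restricted_selections (last (h @ [\<U>])) (\<kappa> (butlast (h @ [\<U>])))"
      using strat that unfolding menger_restricted_winning_strategy_II_def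
      by (metis append_is_Nil_conv insert_subset list.simps(15) not_Cons_self2 set_append
          empty_set Un_subset_iff empty_subsetI)
    then show ?thesis by (simp add: menger_restricted_selections_def)
  qed
  have wins: "\<exists>n. x \<in> \<Union>(set (\<tau> (map \<U> [0..<Suc n])))"
    if \<U>: "\<And>n. \<U> n \<in> open_covers X" and x: "x \<in> topspace X" for \<U> x
  proof -
    obtain n i where "i < length (\<tau> (map \<U> [0..<Suc n]))" "x \<in> \<tau> (map \<U> [0..<Suc n]) ! i"
      using run[of \<U>, OF \<U>] x unfolding menger_restricted_II_wins_run_def
      by (auto simp del: upt_Suc)
    then show ?thesis using nth_mem by blast
  qed
  define C where "C h = \<Union>(set (\<tau> h))" for h
  have C_open: "openin X (C (h @ [\<U>]))" if "set h \<subseteq> open_covers X" "\<U> \<in> open_covers X" for h \<U>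
    using \<tau>[OF that] that(2) unfolding C_def in_open_covers_iff by blast
  have top_cover: "{topspace X} \<in> open_covers X" by (simp add: in_open_covers_iff)
  \<comment> \<open>The empty cover of the empty space admits no legal selection, as
    \<open>\<kappa>\<close> is positive. Nonemptiness makes a total \<open>pt\<close> possible
    below.\<close>
  have ne: "topspace X \<noteq> {}"
  proof
    assume "topspace X = {}"
    then have "{} \<in> open_covers X" by (simp add: in_open_covers_iff)
    then show False using \<tau>[of "[]" "{}"] \<kappa>[of "[]"] by auto
  qed
  have lindelof: "\<exists>\<V>\<subseteq>\<U>. countable \<V> \<and> topspace X \<subseteq> \<Union>\<V>" if \<U>: "\<U> \<in> open_covers X" for \<U>
  proof (intro exI conjI)
    let ?\<V> = "\<Union>n. set (\<tau> (map (\<lambda>_. \<U>) [0..<Suc n]))"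
    show "countable ?\<V>" by (auto intro: countable_finite)
    show "?\<V> \<subseteq> \<U>" using \<tau>[of "map (\<lambda>_. \<U>) [0..<n]" \<U> for n] \<U> by fastforce
    show "topspace X \<subseteq> \<Union>?\<V>" using wins[of "\<lambda>_. \<U>"] \<U> by blast
  qed
  define K where "K h = {x \<in> topspace X. \<forall>\<U>\<in>open_covers X. x \<in> X closure_of C (h @ [\<U>])}" for h
  have fin_K: "finite (K h)" if h: "set h \<subseteq> open_covers X" for h
  proof (rule ccontr)
    assume "infinite (K h)"
    \<comment> \<open>\<open>\<kappa> h\<close> is announced before the cover, so the cover can be
      fitted to \<open>\<kappa> h + 1\<close> points; each selected set has at most one of them in
      its closure.\<close>
    then obtain F where F: "F \<subseteq> K h" "finite F" "card F = Suc (\<kappa> h)"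
      using infinite_arbitrarily_large by metis
    define \<U> where "\<U> =
      {U. openin X U \<and> (\<forall>x\<in>F. \<forall>y\<in>F. x \<in> X closure_of U \<and> y \<in> X closure_of U \<longrightarrow> x = y)}"
    have \<U>: "\<U> \<in> open_covers X"
      unfolding \<U>_def using F by (intro Hausdorff_cover_closures_separating T2) (auto simp: K_def)
    have "\<forall>x\<in>F. \<exists>U\<in>set (\<tau> (h @ [\<U>])). x \<in> X closure_of U"
    proof
      fix x assume "x \<in> F"
      then have "x \<in> X closure_of \<Union>(set (\<tau> (h @ [\<U>])))"
        using F(1) \<U> by (auto simp: K_def C_def)
      then show "\<exists>U\<in>set (\<tau> (h @ [\<U>])). x \<in> X closure_of U"
        by (simp add: closure_of_Union)
    qed
    then obtain u where u: "\<And>x. x \<in> F \<Longrightarrow> u x \<in> set (\<tau> (h @ [\<U>])) \<and> x \<in> X closure_of u x"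
      by metis
    have "inj_on u F"
    proof (rule inj_onI)
      fix x y assume xy: "x \<in> F" "y \<in> F" "u x = u y"
      then have "u x \<in> \<U>" using u \<tau>[OF h \<U>] by blast
      then show "x = y" using u[of x] u[of y] xy unfolding \<U>_def by auto
    qed
    then have "card F \<le> card (set (\<tau> (h @ [\<U>])))"
      using u by (intro card_inj_on_le) auto
    also have "\<dots> \<le> \<kappa> h" using \<tau>[OF h \<U>] card_length by metis
    finally show False using F(3) by simp
  qed
  define separates where "separates h V E \<longleftrightarrow> (\<forall>j. E j \<in> open_covers X) \<and>
      (set h \<subseteq> open_covers X \<and> openin X V \<and> K h \<subseteq> V \<longrightarrow>
        (\<forall>x\<in>topspace X - V. \<exists>j. x \<notin> C (h @ [E j])))" for h V and E :: "nat \<Rightarrow> 'a set set"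
  have "\<exists>E. separates h V E" for h V
  proof (cases "set h \<subseteq> open_covers X \<and> openin X V \<and> K h \<subseteq> V")
    case True
    let ?Y = "\<lambda>\<U>. topspace X - X closure_of C (h @ [\<U>])"
    \<comment> \<open>A point outside every \<open>?Y \<U>\<close> belongs to \<open>K h\<close>,
      hence to \<open>V\<close>.\<close>
    have ins: "insert V (?Y ` open_covers X) \<in> open_covers X"
      using True by (auto simp: in_open_covers_iff K_def)
    obtain \<V> where \<V>: "\<V> \<subseteq> insert V (?Y ` open_covers X)" "countable \<V>" "topspace X \<subseteq> \<Union>\<V>"
      using lindelof[OF ins] by auto
    have "countable (\<V> - {V})" "\<V> - {V} \<subseteq> ?Y ` open_covers X"
      using \<V>(1,2) by auto
    then obtain \<D> where \<D>: "countable \<D>" "\<D> \<subseteq> open_covers X" "\<V> - {V} = ?Y ` \<D>"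
      using countable_subset_image[of "\<V> - {V}" ?Y "open_covers X"] by metis
    \<comment> \<open>\<open>\<D>\<close> may be empty, namely when \<open>V\<close> alone covers
      the space; \<open>topspace X\<close> makes the enumerated set nonempty.\<close>
    define E where "E = from_nat_into (insert {topspace X} \<D>)"
    have E: "range E = insert {topspace X} \<D>"
      unfolding E_def using \<D>(1) by (intro range_from_nat_into) auto
    have "\<exists>j. x \<notin> C (h @ [E j])" if x: "x \<in> topspace X - V" for x
    proof -
      obtain \<U> where \<U>: "\<U> \<in> \<D>" "x \<in> ?Y \<U>" using x \<V>(3) \<D>(3) by blast
      then obtain j where "\<U> = E j" using E by blast
      moreover have "C (h @ [\<U>]) \<subseteq> X closure_of C (h @ [\<U>])"
        using C_open[of h \<U>] True \<D>(2) \<U>(1) by (intro closure_of_subset openin_subset) auto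
      ultimately show ?thesis using \<U>(2) by auto
    qed
    moreover have "E j \<in> open_covers X" for j
      using rangeI[of E j] \<D>(2) top_cover unfolding E by auto
    ultimately have "separates h V E" unfolding separates_def by simp
    then show ?thesis by (rule exI[of "separates h V" E])
  next
    case False
    then show ?thesis
      unfolding separates_def using top_cover by (intro exI[of _ "\<lambda>_. {topspace X}"]) auto
  qed
  then obtain E where "\<And>h V. separates h V (E h V)" by metis
  then have E: "\<And>h V (j::nat). E h V j \<in> open_covers X"
    "\<And>h V x. set h \<subseteq> open_covers X \<Longrightarrow> openin X V \<Longrightarrow> K h \<subseteq> V \<Longrightarrow> x \<in> topspace X - V \<Longrightarrow>
       \<exists>j. x \<notin> C (h @ [E h V j])"
    unfolding separates_def by auto

  text \<open>
    In the state \<open>(h, V)\<close>, a position \<open>h\<close> of the restricted Menger game and a set \<open>V\<close> already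
    covered, player II covers a point of \<open>K h - V\<close> if there is one; otherwise the state branches
    into countably many positions extending \<open>h\<close>.
  \<close>
  have "\<forall>st. \<exists>x\<in>topspace X. \<not> K (fst st) \<subseteq> snd st \<longrightarrow> x \<in> K (fst st) - snd st"
  proof
    fix st :: "'a set set list \<times> 'a set"
    have "K (fst st) \<subseteq> topspace X" by (auto simp: K_def)
    then show "\<exists>x\<in>topspace X. \<not> K (fst st) \<subseteq> snd st \<longrightarrow> x \<in> K (fst st) - snd st"
      using ne by blast
  qed
  then obtain pt where pt: "\<And>st. pt st \<in> topspace X"
    "\<And>st. \<not> K (fst st) \<subseteq> snd st \<Longrightarrow> pt st \<in> K (fst st) - snd st"
    by metis
  \<comment> \<open>Once \<open>K h \<subseteq> V\<close>, the set \<open>U\<close> is ignored and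
    each \<open>j\<close> extends the position by another cover; the covered part restarts from
    \<open>{}\<close> for the new position.\<close>
  define nxt where "nxt = (\<lambda>(h, V) U j. if K h \<subseteq> V then (h @ [E h V j], {}) else (h, V \<union> U))"
  obtain \<rho> where \<rho>: "\<And>\<U>s. \<U>s \<noteq> [] \<Longrightarrow> set \<U>s \<subseteq> open_covers X \<Longrightarrow> \<rho> \<U>s \<in> last \<U>s"
    and reach: "\<And>\<U>. (\<And>n. \<U> n \<in> open_covers X) \<Longrightarrow>
       \<exists>R. ([], {}) \<in> R \<and> (\<forall>st\<in>R. \<exists>n. pt st \<in> \<rho> (map \<U> [0..<Suc n]) \<and>
              (\<forall>j. nxt st (\<rho> (map \<U> [0..<Suc n])) j \<in> R))"
    by (rule rothberger_II_tree_strategy[of pt X "([], {})" nxt, OF pt(1)]) blast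
  have "rothberger_II_wins_run X (\<lambda>n. \<rho> (map \<U> [0..<Suc n]))"
    if \<U>: "\<And>n. \<U> n \<in> open_covers X" for \<U>
  proof -
    define W where "W n = \<rho> (map \<U> [0..<Suc n])" for n
    have W_open: "openin X (W n)" for n
    proof -
      have "W n \<in> \<U> n"
        using \<rho>[of "map \<U> [0..<Suc n]"] \<U> unfolding W_def by (simp add: image_subset_iff)
      then show ?thesis using \<U>[of n] by (auto simp: in_open_covers_iff)
    qed
    obtain R where R: "([], {}) \<in> R"
      "\<And>st. st \<in> R \<Longrightarrow> \<exists>n. pt st \<in> W n \<and> (\<forall>j. nxt st (W n) j \<in> R)"
      using reach[of \<U>] \<U> unfolding W_def by blast
    \<comment> \<open>While \<open>K h\<close> is not covered, each visit adds a neighbourhood of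
      one of its points to \<open>V\<close>; as \<open>K h\<close> is finite, a branching state over
      the same \<open>h\<close> is reached.\<close>
    have fill: "\<exists>V'. (h, V') \<in> R \<and> openin X V' \<and> V' \<subseteq> (\<Union>n. W n) \<and> K h \<subseteq> V'"
      if "(h, V) \<in> R" "openin X V" "V \<subseteq> (\<Union>n. W n)" "set h \<subseteq> open_covers X" for h V
      using that
    proof (induction "card (K h - V)" arbitrary: V rule: less_induct)
      case less
      show ?case
      proof (cases "K h \<subseteq> V")
        case True
        then show ?thesis using less.prems by blast
      next
        case False
        obtain n where n: "pt (h, V) \<in> W n" "\<And>j. nxt (h, V) (W n) j \<in> R"
          using R(2)[OF less.prems(1)] by blast
        have p: "pt (h, V) \<in> K h - V" using pt(2)[of "(h, V)"] False by simp
        have "card (K h - (V \<union> W n)) < card (K h - V)"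
          using fin_K[OF less.prems(4)] p n(1) by (intro psubset_card_mono) auto
        moreover have "(h, V \<union> W n) \<in> R" using n(2) False by (simp add: nxt_def)
        ultimately show ?thesis
          using less.hyps[of "V \<union> W n"] less.prems W_open by blast
      qed
    qed
    have "x \<in> (\<Union>n. W n)" if x: "x \<in> topspace X" for x
    proof (rule ccontr)
      assume unc: "x \<notin> (\<Union>n. W n)"
      \<comment> \<open>A point missed by all \<open>W n\<close> lies outside \<open>V\<close>, so
        along some branch the answer of \<open>\<tau>\<close> avoids it. Iterating gives a run in
        which \<open>\<tau>\<close> never covers \<open>x\<close>.\<close>
      have step: "\<exists>\<A>\<in>open_covers X. (h @ [\<A>], {}) \<in> R \<and> x \<notin> C (h @ [\<A>])"
        if h: "(h, {}) \<in> R" "set h \<subseteq> open_covers X" for h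
      proof -
        obtain V where V: "(h, V) \<in> R" "openin X V" "V \<subseteq> (\<Union>n. W n)" "K h \<subseteq> V"
          using fill[OF h(1)] h(2) by auto
        then obtain j where "x \<notin> C (h @ [E h V j])" using E(2) h(2) x unc by blast
        moreover have "(h @ [E h V j], {}) \<in> R"
          using R(2)[OF V(1)] V(4) by (auto simp: nxt_def)
        ultimately show ?thesis using E(1) by blast
      qed
      obtain g where g: "\<And>n. (g n, {}) \<in> R \<and> set (g n) \<subseteq> open_covers X \<and> length (g n) = n"
        "\<And>n. \<exists>\<A>\<in>open_covers X. g (Suc n) = g n @ [\<A>] \<and> x \<notin> C (g (Suc n))"
      proof (rule exE[OF dependent_nat_choice[where
              P = "\<lambda>n h. (h, {}) \<in> R \<and> set h \<subseteq> open_covers X \<and> length h = n" and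
              Q = "\<lambda>n h h'. \<exists>\<A>\<in>open_covers X. h' = h @ [\<A>] \<and> x \<notin> C h'"]])
        show "\<exists>h. (h, {}) \<in> R \<and> set h \<subseteq> open_covers X \<and> length h = 0"
          using R(1) by simp
        fix h and n :: nat
        assume "(h, {}) \<in> R \<and> set h \<subseteq> open_covers X \<and> length h = n"
        then show "\<exists>h'. ((h', {}) \<in> R \<and> set h' \<subseteq> open_covers X \<and> length h' = Suc n) \<and>
            (\<exists>\<A>\<in>open_covers X. h' = h @ [\<A>] \<and> x \<notin> C h')"
          using step[of h] by fastforce
      qed blast
      define \<A> where "\<A> n = last (g (Suc n))" for n
      have \<A>: "\<A> n \<in> open_covers X" "g (Suc n) = g n @ [\<A> n]" "x \<notin> C (g (Suc n))" for n
        using g(2)[of n] by (auto simp: \<A>_def)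
      have "g n = map \<A> [0..<n]" for n
      proof (induction n)
        case 0
        then show ?case using g(1)[of 0] by simp
      qed (simp add: \<A>(2))
      then have "x \<notin> C (map \<A> [0..<Suc n])" for n using \<A>(3)[of n] by simp
      then show False using wins[of \<A> x] \<A>(1) x unfolding C_def by blast
    qed
    then show ?thesis
      using W_open openin_subset unfolding rothberger_II_wins_run_def W_def by blast
  qed
  then have "rothberger_winning_strategy_II X \<rho>"
    using \<rho> unfolding rothberger_winning_strategy_II_def by blast
  then show ?thesis unfolding rothberger_II_has_winning_strategy_def by blast
qed

theorem theorem2p1:
  fixes X :: "'a topology"
  assumes "Hausdorff_space X"
  shows "(menger_restricted_I_has_winning_strategy X \<longleftrightarrow> rothberger_I_has_winning_strategy X) \<and>
         (menger_restricted_II_has_winning_strategy X \<longleftrightarrow> rothberger_II_has_winning_strategy X)"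
  using assms menger_restricted_I_imp_rothberger_I not_rothberger_space_imp_menger_restricted_I
    rothberger_space_imp_no_winning_strategy_I menger_restricted_II_imp_rothberger_II
    rothberger_II_imp_menger_restricted_II
  by blast

end
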